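(* Let $q$ be a positive integer and let $S=\langle n,n+1,\dots,n+t\rangle$ with integers $1\leq t<n$. Then $$GM_q(S)=1+\sum_{k=0}^{n-1}\min_{1\leq i\leq t}\{q,\ C_{k,i}\},$$ where $k_i=(k-iq)\bmod n$ and $C_{k,i}:=q-\left\lceil\frac{k}{t}\right\rceil+\left\lceil\frac{k_i}{t}\right\rceil+\left\lceil\frac{iq-k}{n}\right\rceil$, and for each $k$ the minimum is over the set consisting of $q$ together with $C_{k,i}$ for $1\leq i\leq t$.
   Context: $\langle n,\dots,n+t\rangle$ is the set of $\mathbb N$-linear combinations of $n,\dots,n+t$. For integers $a$ and $b\geq1$, $a\bmod b$ denotes the remainder in $\{0,\dots,b-1\}$. Write $S^*=S\setminus\{0\}$, $qS^*+S=\{qx+y: x\in S^*,\ y\in S\}$, and $GM_q(S):=\#\big(S\setminus (qS^*+S)\big)+1$. *)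

theory Defs
  imports Complex_Main
begin

definition interval_semigroup :: "nat \<Rightarrow> nat \<Rightarrow> nat set" where
  "interval_semigroup n t = {\<Sum>i\<le>t. c i * (n + i) | c :: nat \<Rightarrow> nat. True}"

definition GM :: "nat \<Rightarrow> nat set \<Rightarrow> nat" where
  "GM q S = card (S - {q * x + y | x y. x \<in> S - {0} \<and> y \<in> S}) + 1"

definition residue_shift :: "nat \<Rightarrow> nat \<Rightarrow> nat \<Rightarrow> nat \<Rightarrow> int" where
  "residue_shift q n k i = (int k - int i * int q) mod int n"

(* Integer-valued: single summands may be negative, so natural-number subtraction must be avoided. *)
definition C :: "nat \<Rightarrow> nat \<Rightarrow> nat \<Rightarrow> nat \<Rightarrow> nat \<Rightarrow> int" where
  "C q n t k i =
     int q - \<lceil>real k / real t\<rceil> + \<lceil>real_of_int (residue_shift q n k i) / real t\<rceil>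
       + \<lceil>real_of_int (int i * int q - int k) / real n\<rceil>"

lemma interval_semigroup_large:
  assumes "1 \<le> t" "1 \<le> n" "n * n \<le> m"
  shows "m \<in> interval_semigroup n t"
proof -
  define b where "b = m mod n"
  define c where "c i = (if i = 0 then m div n - b else if i = 1 then b else 0)" for i :: nat
  have "n \<le> m div n"
    using assms div_le_mono[of "n * n" m n] by simp
  moreover have "b < n"
    using assms by (simp add: b_def)
  ultimately have le: "b \<le> m div n" by simp
  have "(\<Sum>i\<le>t. c i * (n + i)) = (\<Sum>i\<in>{0,1}. c i * (n + i))"
    using assms by (intro sum.mono_neutral_right) (auto simp: c_def)
  also have "\<dots> = (m div n - b) * n + b * (n + 1)"
    by (simp add: c_def)
  also have "\<dots> = (m div n - b + b) * n + b"
    by (simp add: algebra_simps)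
  also have "\<dots> = m"
    using le by (simp add: b_def)
  finally show ?thesis
    unfolding interval_semigroup_def by (metis (mono_tags, lifting) mem_Collect_eq)
qed

(* The cardinality in GM is that of a finite set, so the convention that infinite sets have
   card 0 plays no role for these semigroups. *)
lemma finite_GM_interval_semigroup:
  fixes n t q :: nat
  assumes "1 \<le> t" "1 \<le> n"
  defines "S \<equiv> interval_semigroup n t"
  shows "finite (S - {q * x + y | x y. x \<in> S - {0} \<and> y \<in> S})"
proof (rule finite_subset)
  let ?x = "n * n"
  have x: "?x \<in> S - {0}"
    using assms interval_semigroup_large[of t n ?x] by simp
  show "S - {q * x + y | x y. x \<in> S - {0} \<and> y \<in> S} \<subseteq> {..< q * ?x + n * n}"
  proof
    fix m assume m: "m \<in> S - {q * x + y | x y. x \<in> S - {0} \<and> y \<in> S}"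
    show "m \<in> {..< q * ?x + n * n}"
    proof (rule ccontr)
      assume "m \<notin> {..< q * ?x + n * n}"
      then have "q * ?x + n * n \<le> m" by simp
      then have "m - q * ?x \<in> S" "m = q * ?x + (m - q * ?x)"
        using assms interval_semigroup_large[of t n "m - q * ?x"] by simp_all
      then show False using m x by blast
    qed
  qed
qed simp

end

theory Submission
  imports Defs
begin

text \<open>
  An integer \<open>a n + k\<close> with \<open>0 \<le> k < n\<close> lies in \<open>S\<close> iff \<open>a \<ge> \<lceil>k/t\<rceil>\<close>. Peeling one generator off
  the element of \<open>S\<^sup>*\<close> shows that \<open>m \<in> qS\<^sup>* + S\<close> iff \<open>m - q(n + i) \<in> S\<close> for some \<open>0 \<le> i \<le> t\<close>;
  for \<open>m = a n + k\<close> this is the condition \<open>a \<ge> \<lceil>k/t\<rceil> + C\<^sub>k\<^sub>,\<^sub>i\<close>, where \<open>C\<^sub>k\<^sub>,\<^sub>0 = q\<close>. So the residue class of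
  \<open>k\<close> contributes exactly \<open>min\<^sub>i C\<^sub>k\<^sub>,\<^sub>i\<close> elements to the complement, and these minima are nonnegative
  because \<open>qS\<^sup>* + S \<subseteq> S\<close>.
\<close>

lemma zero_in_interval_semigroup: "0 \<in> interval_semigroup n t"
  unfolding interval_semigroup_def by (auto intro!: exI[of _ "\<lambda>_. 0"])

lemma interval_semigroup_add:
  assumes "x \<in> interval_semigroup n t" "y \<in> interval_semigroup n t"
  shows "x + y \<in> interval_semigroup n t"
proof -
  obtain c d where "x = (\<Sum>i\<le>t. c i * (n + i))" "y = (\<Sum>i\<le>t. d i * (n + i))"
    using assms unfolding interval_semigroup_def by blast
  then have "x + y = (\<Sum>i\<le>t. (c i + d i) * (n + i))"
    by (simp only: sum.distrib distrib_right)
  then show ?thesis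
    unfolding interval_semigroup_def mem_Collect_eq
    by (intro exI[of _ "\<lambda>i. c i + d i"] conjI TrueI)
qed

lemma interval_semigroup_mult:
  "x \<in> interval_semigroup n t \<Longrightarrow> q * x \<in> interval_semigroup n t"
  by (induction q) (auto intro: zero_in_interval_semigroup interval_semigroup_add)

lemma generator_in_interval_semigroup:
  assumes "i \<le> t"
  shows "n + i \<in> interval_semigroup n t"
proof -
  have "(\<Sum>j\<le>t. of_bool (j = i) * (n + j)) = (\<Sum>j\<le>t. if j = i then n + j else 0)"
    by (rule sum.cong) auto
  also have "\<dots> = n + i"
    using assms by simp
  finally have "n + i = (\<Sum>j\<le>t. of_bool (j = i) * (n + j))" ..
  then show ?thesis
    unfolding interval_semigroup_def mem_Collect_eq
    by (intro exI[of _ "\<lambda>j. of_bool (j = i)"] conjI TrueI)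
qed

text \<open>Some coefficient is positive, and lowering it by one splits off a generator. This
  reduces the infinitely many choices of \<open>x\<close> in \<open>q * x + y\<close> to the
  generators.\<close>

lemma interval_semigroup_nonzeroE:
  assumes "x \<in> interval_semigroup n t" "x \<noteq> 0"
  obtains i y where "i \<le> t" "y \<in> interval_semigroup n t" "x = n + i + y"
proof -
  obtain c where c: "x = (\<Sum>i\<le>t. c i * (n + i))"
    using assms unfolding interval_semigroup_def by blast
  with assms(2) obtain i where i: "i \<le> t" "c i \<noteq> 0"
    by auto
  define d where "d = c(i := c i - 1)"
  have "x = c i * (n + i) + (\<Sum>j\<in>{..t} - {i}. c j * (n + j))"
    using c i by (simp add: sum.remove)
  also have "(\<Sum>j\<in>{..t} - {i}. c j * (n + j)) = (\<Sum>j\<in>{..t} - {i}. d j * (n + j))"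
    by (rule sum.cong) (auto simp: d_def)
  also have "c i * (n + i) = n + i + d i * (n + i)"
    using i by (cases "c i") (auto simp: d_def)
  finally have "x = n + i + (d i * (n + i) + (\<Sum>j\<in>{..t} - {i}. d j * (n + j)))"
    by simp
  also have "d i * (n + i) + (\<Sum>j\<in>{..t} - {i}. d j * (n + j)) = (\<Sum>j\<le>t. d j * (n + j))"
    using i by (simp add: sum.remove)
  finally show ?thesis
    using that[OF i(1)] unfolding interval_semigroup_def by blast
qed

text \<open>Greedy choice: each of the \<open>a\<close> generators absorbs up to \<open>t\<close> of
  the excess \<open>k\<close>, so at most \<open>a * t\<close> is left after the first one. Here
  \<open>k\<close> may exceed \<open>n\<close>.\<close>

lemma interval_semigroupI:
  assumes "k \<le> a * t"
  shows "a * n + k \<in> interval_semigroup n t"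
  using assms
proof (induction a arbitrary: k)
  case 0
  then show ?case by (simp add: zero_in_interval_semigroup)
next
  case (Suc a)
  have "a * n + (k - min k t) \<in> interval_semigroup n t"
    using Suc.prems by (intro Suc.IH) auto
  from interval_semigroup_add[OF generator_in_interval_semigroup this, of "min k t"]
  show ?case by (simp add: algebra_simps)
qed

lemma in_interval_semigroup_iff:
  assumes "0 < n"
  shows "m \<in> interval_semigroup n t \<longleftrightarrow> m mod n \<le> m div n * t"
proof
  assume "m \<in> interval_semigroup n t"
  then obtain c where c: "m = (\<Sum>i\<le>t. c i * (n + i))"
    unfolding interval_semigroup_def by blast
  define J R where "J = (\<Sum>i\<le>t. c i)" and "R = (\<Sum>i\<le>t. c i * i)"
  have m: "m = J * n + R"
    by (simp add: c J_def R_def distrib_left sum.distrib sum_distrib_right)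
  have "R \<le> J * t"
    unfolding J_def R_def sum_distrib_right by (intro sum_mono) simp
  \<comment> \<open>Carrying \<open>R div n\<close> into the quotient lowers the remainder and
    raises the bound, so the inequality survives reduction modulo \<open>n\<close>.\<close>
  then have "R mod n \<le> (J + R div n) * t"
    by (simp add: add_mult_distrib le_trans[OF mod_less_eq_dividend] trans_le_add1)
  then show "m mod n \<le> m div n * t"
    using assms by (simp add: m)
next
  assume "m mod n \<le> m div n * t"
  from interval_semigroupI[OF this, of n] show "m \<in> interval_semigroup n t"
    by simp
qed

text \<open>Passing to integers allows differences such as \<open>m - q * (n + i)\<close> to be
  negative: then the quotient is negative, the remainder is not, and the criterion fails as it
  should.\<close>

lemma in_int_image_interval_semigroup_iff:
  assumes "0 < n" "0 < t"
  shows "x \<in> int ` interval_semigroup n t \<longleftrightarrow> x mod int n \<le> x div int n * int t"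
proof (cases "0 \<le> x")
  case True
  then obtain m where "x = int m" by (metis nonneg_int_cases)
  then have "x \<in> int ` interval_semigroup n t \<longleftrightarrow> m \<in> interval_semigroup n t"
    by auto
  also have "\<dots> \<longleftrightarrow> int (m mod n) \<le> int (m div n * t)"
    using assms by (simp only: in_interval_semigroup_iff of_nat_le_iff)
  finally show ?thesis
    using \<open>x = int m\<close> by (simp add: of_nat_mod of_nat_div)
next
  case False
  then have "x div int n * int t < 0"
    using assms by (simp add: mult_less_0_iff pos_imp_zdiv_neg_iff)
  moreover have "0 \<le> x mod int n"
    using assms by simp
  ultimately have "\<not> x mod int n \<le> x div int n * int t"
    by linarith
  moreover have "x \<notin> int ` interval_semigroup n t"
    using False by auto
  ultimately show ?thesis by blast
qed

text \<open>The least \<open>a\<close> with \<open>a * n + k\<close> in the semigroup, so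
  \<open>threshold n t k * n + k\<close> is the Apery element of the class of \<open>k\<close>
  modulo \<open>n\<close>. Subtracting \<open>k div n\<close> admits every integer \<open>k\<close>,
  in particular \<open>k - i * q\<close>.\<close>

definition threshold :: "nat \<Rightarrow> nat \<Rightarrow> int \<Rightarrow> int" where
  "threshold n t k = \<lceil>real_of_int (k mod int n) / real t\<rceil> - k div int n"

lemma in_interval_semigroup_iff_threshold:
  assumes "0 < n" "0 < t"
  shows "a * int n + k \<in> int ` interval_semigroup n t \<longleftrightarrow> threshold n t k \<le> a"
proof -
  have "threshold n t k \<le> a \<longleftrightarrow> real_of_int (k mod int n) / real t \<le> real_of_int (a + k div int n)"
    unfolding threshold_def ceiling_le_iff[symmetric] by linarith
  also have "\<dots> \<longleftrightarrow> real_of_int (k mod int n) \<le> real_of_int ((a + k div int n) * int t)"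
    using assms by (simp add: pos_divide_le_eq)
  also have "\<dots> \<longleftrightarrow> k mod int n \<le> (a + k div int n) * int t"
    by (simp only: of_int_le_iff)
  finally show ?thesis
    using assms by (simp add: in_int_image_interval_semigroup_iff)
qed

lemma C_eq_threshold:
  assumes "k < n"
  shows "C q n t k i = int q + threshold n t (int k - int i * int q) - threshold n t (int k)"
proof -
  \<comment> \<open>The ceiling of a negated quotient is the negated floor.\<close>
  have "\<lceil>real_of_int (int i * int q - int k) / real n\<rceil> = - ((int k - int i * int q) div int n)"
    using ceiling_divide_eq_div[of "int i * int q - int k" "int n"] by simp
  then show ?thesis
    using assms by (simp add: C_def residue_shift_def threshold_def)
qed

text \<open>If \<open>x = n + i + z\<close>, then \<open>q * z\<close> can be moved into the summand
  \<open>y\<close>, since the semigroup is closed under addition and multiples.\<close>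

lemma in_scaled_sum_iff:
  fixes n t :: nat
  assumes "0 < n"
  defines "S \<equiv> interval_semigroup n t"
  shows "m \<in> {q * x + y | x y. x \<in> S - {0} \<and> y \<in> S} \<longleftrightarrow>
    (\<exists>i\<le>t. int m - int q * int (n + i) \<in> int ` S)"
proof
  assume "m \<in> {q * x + y | x y. x \<in> S - {0} \<and> y \<in> S}"
  then obtain x y where xy: "m = q * x + y" "x \<in> S" "x \<noteq> 0" "y \<in> S"
    by blast
  then obtain i z where iz: "i \<le> t" "z \<in> S" "x = n + i + z"
    unfolding S_def by (blast elim: interval_semigroup_nonzeroE)
  have "int m - int q * int (n + i) = int (q * z + y)"
    unfolding xy iz by (simp add: algebra_simps)
  moreover have "q * z + y \<in> S"
    using xy iz unfolding S_def by (blast intro: interval_semigroup_add interval_semigroup_mult)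
  ultimately show "\<exists>i\<le>t. int m - int q * int (n + i) \<in> int ` S"
    using iz by blast
next
  assume "\<exists>i\<le>t. int m - int q * int (n + i) \<in> int ` S"
  then obtain i y where iy: "i \<le> t" "y \<in> S" "int m - int q * int (n + i) = int y"
    by blast
  then have "int m = int (q * (n + i) + y)"
    by simp
  then have "m = q * (n + i) + y"
    by (simp only: of_nat_eq_iff)
  moreover have "n + i \<in> S - {0}"
    using iy assms by (simp add: generator_in_interval_semigroup)
  ultimately show "m \<in> {q * x + y | x y. x \<in> S - {0} \<and> y \<in> S}"
    using iy by blast
qed

text \<open>Subtracting \<open>q * (n + i)\<close> lowers \<open>a\<close> by \<open>q\<close> and
  \<open>k\<close> by \<open>i * q\<close>; \<open>C\<close> is the resulting rise of the
  threshold.\<close>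

lemma in_shifted_interval_semigroup_iff:
  assumes "0 < t" "k < n"
  shows "a * int n + int k - int q * int (n + i) \<in> int ` interval_semigroup n t
    \<longleftrightarrow> threshold n t (int k) + C q n t k i \<le> a"
proof -
  have "a * int n + int k - int q * int (n + i) = (a - int q) * int n + (int k - int i * int q)"
    by (simp add: algebra_simps)
  moreover have "threshold n t (int k) + C q n t k i \<le> a
      \<longleftrightarrow> threshold n t (int k - int i * int q) \<le> a - int q"
    using assms by (auto simp: C_eq_threshold)
  ultimately show ?thesis
    using assms by (simp only: in_interval_semigroup_iff_threshold)
qed

lemma C_nonneg:
  assumes "0 < t" "k < n" "i \<le> t"
  shows "0 \<le> C q n t k i"
proof -
  \<comment> \<open>The boundary value: the shifted number is just in the semigroup, and adding
    \<open>q * (n + i)\<close> back stays there, so \<open>a\<close> is at least the threshold of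
    \<open>k\<close>.\<close>
  define a where "a = threshold n t (int k) + C q n t k i"
  have "a * int n + int k - int q * int (n + i) \<in> int ` interval_semigroup n t"
    using assms by (simp only: in_shifted_interval_semigroup_iff a_def)
  then obtain y where y: "y \<in> interval_semigroup n t"
    and "a * int n + int k - int q * int (n + i) = int y"
    by blast
  then have eq: "a * int n + int k = int (y + q * (n + i))"
    by simp
  have "y + q * (n + i) \<in> interval_semigroup n t"
    using y assms
    by (blast intro: interval_semigroup_add interval_semigroup_mult generator_in_interval_semigroup)
  then have "a * int n + int k \<in> int ` interval_semigroup n t"
    unfolding eq by blast
  then show ?thesis
    using assms by (simp add: in_interval_semigroup_iff_threshold a_def)
qed

theorem theorem4p1:
  fixes q n t :: nat
  assumes "1 \<le> q" "1 \<le> t" "t < n"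
  shows "int (GM q (interval_semigroup n t)) =
    1 + (\<Sum>k = 0..n - 1. Min (insert (int q) ((\<lambda>i. C q n t k i) ` {1..t})))"
proof -
  define S where "S = interval_semigroup n t"
  define D where "D = S - {q * x + y | x y. x \<in> S - {0} \<and> y \<in> S}"
  define w where "w k = threshold n t (int k)" for k
  define M where "M k = Min (insert (int q) ((\<lambda>i. C q n t k i) ` {1..t}))" for k
  \<comment> \<open>A pair \<open>(k, a)\<close> encodes \<open>a * n + k\<close>; the fibre over
    \<open>k\<close> is an interval of length \<open>M k\<close>.\<close>
  define A where "A = (SIGMA k:{..<n}. {w k..<w k + M k})"
  have pos: "0 < n" "0 < t"
    using assms by auto
  have M: "M k = Min ((\<lambda>i. C q n t k i) ` {..t})" if "k < n" for k
  proof -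
    \<comment> \<open>The extra entry \<open>q\<close> of the minimum is the value of
      \<open>C\<close> at \<open>i = 0\<close>, coming from the generator \<open>n\<close>.\<close>
    have "{..t} = insert 0 {1..t}" by auto
    then show ?thesis
      using that by (simp add: M_def C_eq_threshold)
  qed
  have M_nonneg: "0 \<le> M k" if "k < n" for k
    using that pos by (auto simp: M C_nonneg)
  have mem_D: "a * int n + int k \<in> int ` D \<longleftrightarrow> a \<in> {w k..<w k + M k}" if k: "k < n" for a k
  proof -
    let ?x = "a * int n + int k"
    have "?x \<in> int ` D \<longleftrightarrow> ?x \<in> int ` S \<and> \<not> (\<exists>i\<le>t. ?x - int q * int (n + i) \<in> int ` S)"
      using in_scaled_sum_iff[OF pos(1), where t = t and q = q, folded S_def]
      unfolding D_def by (auto simp: image_iff)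
    also have "\<dots> \<longleftrightarrow> w k \<le> a \<and> \<not> (\<exists>i\<le>t. w k + C q n t k i \<le> a)"
      using in_interval_semigroup_iff_threshold[OF pos, of a "int k"]
        in_shifted_interval_semigroup_iff[OF pos(2) k, of a q]
      by (simp only: S_def w_def)
    also have "\<dots> \<longleftrightarrow> w k \<le> a \<and> (\<forall>i\<le>t. a - w k < C q n t k i)"
      by (auto simp: algebra_simps)
    also have "\<dots> \<longleftrightarrow> w k \<le> a \<and> a - w k < M k"
      using k by (auto simp: M)
    finally show ?thesis by auto
  qed
  have "bij_betw (\<lambda>(k, a). a * int n + int k) A (int ` D)"
  proof (rule bij_betw_imageI)
    show "inj_on (\<lambda>(k, a). a * int n + int k) A"
    proof (rule inj_on_inverseI)
      fix p assume "p \<in> A"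
      \<comment> \<open>Division with remainder by \<open>n\<close> inverts the encoding.\<close>
      then show "(\<lambda>x. (nat (x mod int n), x div int n)) ((\<lambda>(k, a). a * int n + int k) p) = p"
        by (auto simp: A_def)
    qed
    show "(\<lambda>(k, a). a * int n + int k) ` A = int ` D"
    proof (intro equalityI subsetI)
      fix x assume "x \<in> (\<lambda>(k, a). a * int n + int k) ` A"
      then obtain k a where "x = a * int n + int k" "k < n" "a \<in> {w k..<w k + M k}"
        by (auto simp: A_def)
      then show "x \<in> int ` D"
        using mem_D by blast
    next
      fix x assume x: "x \<in> int ` D"
      define k a where "k = nat (x mod int n)" and "a = x div int n"
      have k: "k < n" "x = a * int n + int k"
        using pos by (simp_all add: k_def a_def nat_less_iff)
      then have "(k, a) \<in> A"
        using x mem_D[of k a] by (simp add: A_def)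
      then show "x \<in> (\<lambda>(k, a). a * int n + int k) ` A"
        using k by (auto intro: image_eqI[of _ _ "(k, a)"])
    qed
  qed
  then have "card D = card A"
    by (metis bij_betw_same_card card_image inj_on_of_nat)
  also have "\<dots> = (\<Sum>k<n. nat (M k))"
    unfolding A_def by simp
  \<comment> \<open>Nonnegativity of \<open>M k\<close> ensures that \<open>nat\<close> truncates
    nothing.\<close>
  finally have "int (card D) = (\<Sum>k<n. M k)"
    using M_nonneg by simp
  moreover have "{..<n} = {0..n - 1}"
    using pos by auto
  ultimately show ?thesis
    unfolding GM_def M_def D_def S_def by simp
qed

end
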